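(* $\text{HG}_s(\mathcal{P}ath)= 4s-2$. More precisely, a) $\text{HG}_s(P_n) < 4s-1$ for all $n$; b) $\text{HG}_s(P_n) = 4s-2$ for $n\geq 2s$.
   Context: Hat guessing game $\langle G, h, g\rangle$: a sage sits at each vertex $v$ of the graph $G$; an adversary puts on the head of each sage $v$ a hat whose color is chosen from $\{0,1,\dots,h(v)-1\}$; each sage sees the hat colors of his neighbours but not his own; without communication, each sage $v$ names a list of $g(v)$ colors, determined by a deterministic strategy (fixed in advance and known to the adversary) from the colors he sees. The game is winning if there is a strategy guaranteeing that for every hat assignment at least one sage's list contains his own hat color. For a graph $G$ and integer $s\ge 1$, $\text{HG}_s(G)$ is the maximal $k$ such that the game with $h$ constantly equal to $k$ and $g$ constantly equal to $s$ is winning. For a class $\mathcal{C}$ of graphs, $\text{HG}_s(\mathcal{C})=\sup\{\text{HG}_s(G): G\in\mathcal{C}\}$. $P_n$ is the path on $n$ vertices and $\mathcal{P}ath$ is the class of all paths. Here $s\ge 1$ is an integer. *)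

theory Defs
  imports
    "HOL-Library.FuncSet"
    "HOL-Library.Extended_Nat"
    "Graph_Theory.Pair_Digraph"
begin

text \<open>
  A finite simple graph is an element of locale \<^locale>\<open>pair_graph\<close>: every undirected edge is
  represented by its two orientations.
\<close>

definition neighbours :: "'v pair_pre_digraph \<Rightarrow> 'v \<Rightarrow> 'v set" where
  "neighbours G v = {u. (v, u) \<in> parcs G}"

definition hat_colourings :: "('v \<Rightarrow> nat) \<Rightarrow> 'v set \<Rightarrow> ('v \<Rightarrow> nat) set" where
  "hat_colourings h A = (\<Pi>\<^sub>E v\<in>A. {..<h v})"

text \<open>
  The guess of the sage \<open>v\<close> is a function of the colouring of the neighbours of \<open>v\<close> only.
  Colours may be repeated in a list; as long as \<open>g v \<le> h v\<close>, demanding distinct colours would not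
  affect who wins.
\<close>

definition strategies ::
    "'v pair_pre_digraph \<Rightarrow> ('v \<Rightarrow> nat) \<Rightarrow> ('v \<Rightarrow> nat) \<Rightarrow> ('v \<Rightarrow> ('v \<Rightarrow> nat) \<Rightarrow> nat list) set" where
  "strategies G h g =
    (\<Pi> v\<in>pverts G. hat_colourings h (neighbours G v) \<rightarrow> {xs. set xs \<subseteq> {..<h v} \<and> length xs = g v})"

definition winning_game :: "'v pair_pre_digraph \<Rightarrow> ('v \<Rightarrow> nat) \<Rightarrow> ('v \<Rightarrow> nat) \<Rightarrow> bool" where
  "winning_game G h g \<longleftrightarrow>
    (\<exists>f\<in>strategies G h g. \<forall>c\<in>hat_colourings h (pverts G). \<exists>v\<in>pverts G.
       c v \<in> set (f v (restrict c (neighbours G v))))"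

text \<open>
  The supremum in \<^typ>\<open>enat\<close> is the maximal winning \<open>k\<close> if there is one, and infinite if there are
  arbitrarily large winning \<open>k\<close>; see lemma \<open>HG_eq_enat_iff\<close> below.
\<close>

definition HG :: "nat \<Rightarrow> 'v pair_pre_digraph \<Rightarrow> enat" where
  "HG s G = (SUP k\<in>{k. winning_game G (\<lambda>_. k) (\<lambda>_. s)}. enat k)"

definition HG_class :: "nat \<Rightarrow> 'v pair_pre_digraph set \<Rightarrow> enat" where
  "HG_class s C = (SUP G\<in>C. HG s G)"

definition path_graph :: "nat \<Rightarrow> nat pair_pre_digraph" where
  "path_graph n =
    \<lparr> pverts = {..<n}, parcs = {(i, j). i < n \<and> j < n \<and> (j = Suc i \<or> i = Suc j)} \<rparr>"

definition paths :: "nat pair_pre_digraph set" where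
  "paths = path_graph ` {1..}"

lemma pair_graph_path_graph: "pair_graph (path_graph n)"
proof -
  have "parcs (path_graph n) \<subseteq> {..<n} \<times> {..<n}"
    by (auto simp: path_graph_def)
  then have "finite (parcs (path_graph n))"
    by (rule finite_subset) simp
  then show ?thesis
    by unfold_locales (auto simp: path_graph_def symmetric_def intro!: symI)
qed

lemma winning_game_1:
  assumes "pverts G \<noteq> {}" "s \<ge> 1"
  shows "winning_game G (\<lambda>_. 1) (\<lambda>_. s)"
proof -
  obtain v where v: "v \<in> pverts G" using assms by blast
  have "(\<lambda>_ _. replicate s 0) \<in> strategies G (\<lambda>_. 1) (\<lambda>_. s)"
    by (auto simp: strategies_def)
  moreover have "c v \<in> set (replicate s 0)" if "c \<in> hat_colourings (\<lambda>_. 1) (pverts G)" for c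
    using that v assms(2) by (auto simp: hat_colourings_def PiE_iff)
  ultimately show ?thesis
    unfolding winning_game_def using v by (intro bexI[of _ "\<lambda>_ _. replicate s 0"] ballI bexI[of _ v])
qed

lemma HG_eq_enat_iff:
  assumes "pverts G \<noteq> {}" "s \<ge> 1"
  shows "HG s G = enat k \<longleftrightarrow>
    winning_game G (\<lambda>_. k) (\<lambda>_. s) \<and> (\<forall>j. winning_game G (\<lambda>_. j) (\<lambda>_. s) \<longrightarrow> j \<le> k)"
    (is "_ \<longleftrightarrow> ?W k \<and> _")
proof
  assume HG: "HG s G = enat k"
  have le: "j \<le> k" if "?W j" for j
  proof -
    have "enat j \<le> HG s G" unfolding HG_def by (rule SUP_upper) (simp add: that)
    then show ?thesis by (simp add: HG)
  qed
  have fin: "finite {j. ?W j}" by (rule finite_subset[of _ "{..k}"]) (auto dest: le)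
  have ne: "{j. ?W j} \<noteq> {}" using winning_game_1[OF assms] by blast
  define m where "m = Max {j. ?W j}"
  have m: "?W m" using Max_in[OF fin ne] by (simp add: m_def)
  have "HG s G \<le> enat m" unfolding HG_def
    by (rule SUP_least) (use fin in \<open>auto simp: m_def\<close>)
  then have "m = k" using HG le[OF m] by simp
  then show "?W k \<and> (\<forall>j. ?W j \<longrightarrow> j \<le> k)" using m le by blast
next
  assume "?W k \<and> (\<forall>j. ?W j \<longrightarrow> j \<le> k)"
  then show "HG s G = enat k" unfolding HG_def
    by (intro antisym SUP_least SUP_upper) auto
qed

end

theory Submission
  imports Defs
begin

text \<open>
  Upper bound: scan the path from left to right, keeping the pairs of colours of two consecutive
  sages that extend to a colouring of the left part on which every guess there fails. If \<open>k \<ge> 4 s - 1\<close>,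
  double counting shows by induction that, whatever the colour of the next sage, more than half of
  the colours of the current sage remain possible.

  Lower bound, with \<open>k = 4 s - 2\<close>: let the sages at distance \<open>i < s\<close> from the left end make sure
  that, if all their guesses fail, the colour of sage \<open>i\<close> avoids a cyclic interval of length \<open>s + i\<close>
  that is determined by the colour of the next sage. The intervals attached to consecutive colours
  are laid end to end around the cycle, hence cover it evenly, and \<open>s\<close> guesses are just enough to
  enlarge the forbidden interval by one in each step. After \<open>s\<close> steps from either end, the two
  forbidden intervals of length \<open>2 s - 1\<close> leave no pair of colours for the two middle sages.
\<close>

lemma neighbours_path_graph:
  "neighbours (path_graph n) v = {u. v < n \<and> u < n \<and> (u = Suc v \<or> v = Suc u)}"
  by (auto simp: neighbours_def path_graph_def)

lemma pverts_path_graph [simp]: "pverts (path_graph n) = {..<n}"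
  by (simp add: path_graph_def)

text \<open>Lets a strategy be given by sets of at most \<open>g v\<close> colours;
  \<open>0 < h v\<close> makes padding the list with colour 0 legal.\<close>

lemma winning_gameI:
  assumes range: "\<And>v c. v \<in> pverts G \<Longrightarrow> F v c \<subseteq> {..<h v}"
    and card: "\<And>v c. v \<in> pverts G \<Longrightarrow> c \<in> hat_colourings h (neighbours G v) \<Longrightarrow> card (F v c) \<le> g v"
    and pos: "\<And>v. v \<in> pverts G \<Longrightarrow> 0 < h v"
    and win: "\<And>c. c \<in> hat_colourings h (pverts G) \<Longrightarrow>
      \<exists>v\<in>pverts G. c v \<in> F v (restrict c (neighbours G v))"
  shows "winning_game G h g"
proof -
  define f where "f v c = sorted_list_of_set (F v c) @ replicate (g v - card (F v c)) 0" for v c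
  have fin: "finite (F v c)" if "v \<in> pverts G" for v c
    using range[OF that] by (rule finite_subset) simp
  have sub: "F v c \<subseteq> set (f v c)" if "v \<in> pverts G" for v c
    using fin[OF that] by (auto simp: f_def)
  have "f \<in> strategies G h g"
    unfolding strategies_def
  proof (intro Pi_I CollectI conjI)
    fix v c assume v: "v \<in> pverts G" and c: "c \<in> hat_colourings h (neighbours G v)"
    show "set (f v c) \<subseteq> {..<h v}"
      using fin[OF v] range[OF v] pos[OF v] by (auto simp: f_def)
    show "length (f v c) = g v"
      using card[OF v c] by (simp add: f_def)
  qed
  then show ?thesis
    unfolding winning_game_def using win sub by (meson subsetD)
qed

subsection \<open>The upper bound\<close>

text \<open>Count pairs \<open>(a, b)\<close> with \<open>b\<close> forced and \<open>a\<close> in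
  \<open>D b\<close>: each \<open>b\<close> yields more than \<open>k / 2\<close> of them, each
  \<open>a\<close> at most \<open>s\<close>, so there are at most \<open>k * s\<close> in
  all.\<close>

lemma card_forced_less:
  fixes k s :: nat and D h :: "nat \<Rightarrow> nat set"
  assumes D: "\<And>b. b < k \<Longrightarrow> D b \<subseteq> {..<k}" "\<And>b. b < k \<Longrightarrow> k < 2 * card (D b)"
    and h: "\<And>a. finite (h a)" "\<And>a. card (h a) \<le> s"
    and "s \<ge> 1"
  shows "card {b. b < k \<and> (\<forall>a\<in>D b. b \<in> h a)} < 2 * s"
proof -
  let ?B = "{b. b < k \<and> (\<forall>a\<in>D b. b \<in> h a)}"
  have finB: "finite ?B" by simp
  have "(\<Sum>b\<in>?B. card (D b)) = card (SIGMA b:?B. D b)"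
    using D(1) by (intro card_SigmaI[symmetric]) (auto intro: finite_subset)
  also have "\<dots> = card (prod.swap ` (SIGMA b:?B. D b))"
    by (rule card_image[symmetric]) (auto intro: inj_onI)
  also have "\<dots> \<le> card (SIGMA a:{..<k}. h a)"
    using h(1) subsetD[OF D(1)] by (intro card_mono finite_SigmaI) auto
  also have "\<dots> = (\<Sum>a<k. card (h a))"
    using h(1) by simp
  also have "\<dots> \<le> (\<Sum>a<k. s)"
    using h(2) by (intro sum_mono)
  finally have le: "(\<Sum>b\<in>?B. card (D b)) \<le> k * s" by simp
  show ?thesis
  proof (cases "?B = {}")
    case True
    then show ?thesis using \<open>s \<ge> 1\<close> by (simp only: card.empty)
  next
    case False
    have "card ?B * k = (\<Sum>b\<in>?B. k)" by simp
    also have "\<dots> < (\<Sum>b\<in>?B. 2 * card (D b))"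
      using finB False D(2) by (intro sum_strict_mono) auto
    also have "\<dots> = 2 * (\<Sum>b\<in>?B. card (D b))"
      by (simp add: sum_distrib_left)
    also have "\<dots> \<le> 2 * s * k" using le by (simp add: mult.commute)
    finally show ?thesis by simp
  qed
qed

text \<open>
  Sage \<open>v\<close> sits at position \<open>v + 1\<close>; position \<open>0\<close> carries a dummy left neighbour of the first sage,
  so that the base case is void.
\<close>

lemma majority_extendable:
  fixes g :: "nat \<Rightarrow> nat \<Rightarrow> nat \<Rightarrow> nat set"
  assumes g: "\<And>v a b. finite (g v a b)" "\<And>v a b. card (g v a b) \<le> s"
    and s: "s \<ge> 1" and k: "k \<ge> 4 * s - 1" and "x < k"
  shows "k < 2 * card {b. b < k \<and> (\<exists>c. (\<forall>v. c v < k) \<and> c i = b \<and> c (Suc i) = x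
    \<and> (\<forall>v<i. c (Suc v) \<notin> g v (c v) (c (Suc (Suc v)))))}"
    (is "_ < 2 * card (?D i x)")
  using \<open>x < k\<close>
proof (induction i arbitrary: x)
  case 0
  have "?D 0 x = {..<k}"
  proof (intro equalityI subsetI)
    fix b assume "b \<in> {..<k}"
    then have "(\<forall>v. (\<lambda>v. if v = 0 then b else x) v < k)" using 0 by simp
    then show "b \<in> ?D 0 x"
      using \<open>b \<in> {..<k}\<close> by (intro CollectI conjI exI[of _ "\<lambda>v. if v = 0 then b else x"]) auto
  qed auto
  then show ?case using 0 by simp
next
  case (Suc i)
  let ?B = "{b. b < k \<and> (\<forall>a\<in>?D i b. b \<in> g i a x)}"
  have "card ?B < 2 * s"
    using Suc.IH g s by (intro card_forced_less) auto
  moreover have "{..<k} - ?B \<subseteq> ?D (Suc i) x"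
  proof
    fix b assume "b \<in> {..<k} - ?B"
    then obtain a where b: "b < k" and a: "a \<in> ?D i b" "b \<notin> g i a x" by auto
    then obtain c where c: "\<forall>v. c v < k" "c i = a" "c (Suc i) = b"
      "\<forall>v<i. c (Suc v) \<notin> g v (c v) (c (Suc (Suc v)))" by auto
    let ?c = "c(Suc (Suc i) := x)"
    have "\<forall>v. ?c v < k" using c(1) Suc.prems by simp
    moreover have "?c (Suc i) = b" "?c (Suc (Suc i)) = x" using c(3) by simp_all
    moreover have "\<forall>v<Suc i. ?c (Suc v) \<notin> g v (?c v) (?c (Suc (Suc v)))"
      using c a(2) by (auto simp: less_Suc_eq)
    ultimately show "b \<in> ?D (Suc i) x" using b by blast
  qed
  then have "card ({..<k} - ?B) \<le> card (?D (Suc i) x)"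
    by (intro card_mono) auto
  moreover have "card ({..<k} - ?B) = k - card ?B"
    by (subst card_Diff_subset) auto
  \<comment> \<open>At most \<open>2 * s - 1\<close> colours are lost, and
    \<open>k - (2 * s - 1) > k / 2\<close> amounts to \<open>k \<ge> 4 * s - 1\<close>.\<close>
  ultimately show ?case using k s by linarith
qed

lemma winning_path_graph_less:
  assumes s: "s \<ge> 1" and win: "winning_game (path_graph n) (\<lambda>_. k) (\<lambda>_. s)"
  shows "k < 4 * s - 1"
proof (rule ccontr)
  assume "\<not> k < 4 * s - 1"
  then have k: "k \<ge> 4 * s - 1" and k0: "0 < k" using s by linarith+
  let ?N = "neighbours (path_graph n)"
  obtain f where f: "f \<in> strategies (path_graph n) (\<lambda>_. k) (\<lambda>_. s)"
    and win: "\<And>c. c \<in> hat_colourings (\<lambda>_. k) {..<n} \<Longrightarrow> \<exists>v<n. c v \<in> set (f v (restrict c (?N v)))"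
    using win unfolding winning_game_def by (auto simp: Bex_def)
  \<comment> \<open>Restricting to the neighbours hides the dummy colours from the end sages; the
    empty default makes the bounds on \<open>g\<close> unconditional.\<close>
  define g where "g v a b = (if v < n \<and> a < k \<and> b < k
    then set (f v (restrict (\<lambda>u. if u < v then a else b) (?N v))) else {})" for v a b
  have "card (g v a b) \<le> s" for v a b
  proof (cases "v < n \<and> a < k \<and> b < k")
    case True
    let ?c = "restrict (\<lambda>u. if u < v then a else b) (?N v)"
    have "?c \<in> hat_colourings (\<lambda>_. k) (?N v)"
      using True by (auto simp: hat_colourings_def)
    then have "length (f v ?c) = s"
      using f True unfolding strategies_def by (auto simp: Pi_iff)
    then show ?thesis using True card_length[of "f v ?c"] by (simp add: g_def)
  qed (auto simp: g_def)
  moreover have "finite (g v a b)" for v a b by (simp add: g_def)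
  \<comment> \<open>Position \<open>Suc n\<close> carries a dummy right neighbour of the last sage,
    coloured 0.\<close>
  ultimately have "k < 2 * card {b. b < k \<and> (\<exists>c. (\<forall>v. c v < k) \<and> c n = b \<and> c (Suc n) = 0
      \<and> (\<forall>v<n. c (Suc v) \<notin> g v (c v) (c (Suc (Suc v)))))}"
    using s k k0 by (intro majority_extendable[where s = s]) auto
  then have "{b. b < k \<and> (\<exists>c. (\<forall>v. c v < k) \<and> c n = b \<and> c (Suc n) = 0
      \<and> (\<forall>v<n. c (Suc v) \<notin> g v (c v) (c (Suc (Suc v)))))} \<noteq> {}"
    by (metis card.empty mult_0_right not_less0)
  then obtain c where c: "\<And>v. c v < k" "\<And>v. v < n \<Longrightarrow> c (Suc v) \<notin> g v (c v) (c (Suc (Suc v)))"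
    by blast
  let ?c = "\<lambda>v\<in>{..<n}. c (Suc v)"
  have "?c \<in> hat_colourings (\<lambda>_. k) {..<n}"
    using c(1) by (auto simp: hat_colourings_def)
  then obtain v where v: "v < n" "?c v \<in> set (f v (restrict ?c (?N v)))"
    using win by blast
  moreover have "restrict ?c (?N v) = restrict (\<lambda>u. if u < v then c v else c (Suc (Suc v))) (?N v)"
    by (auto simp: neighbours_path_graph)
  ultimately show False using c by (auto simp: g_def)
qed

subsection \<open>The lower bound\<close>

definition cyclic_interval :: "nat \<Rightarrow> nat \<Rightarrow> nat \<Rightarrow> nat set" where
  "cyclic_interval k x m = (\<lambda>j. (x + j) mod k) ` {..<m}"

lemma cyclic_interval_subset: "0 < k \<Longrightarrow> cyclic_interval k x m \<subseteq> {..<k}"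
  by (auto simp: cyclic_interval_def)

text \<open>
  The consecutive intervals wind around the cycle at least \<open>i\<close> times, so \<open>a\<close> lies in at least \<open>i\<close>
  of them.
\<close>

lemma card_uncovered_le:
  assumes a: "a < k" and m: "m < k" and wind: "i * k \<le> m * M"
  shows "card {b \<in> cyclic_interval k x M. a \<notin> cyclic_interval k (m * b) m} \<le> M - i"
proof -
  define b where "b j = (x + j) mod k" for j
  define J where "J = {j. j < M \<and> a \<in> cyclic_interval k (m * b j) m}"
  \<comment> \<open>This is \<open>a - m * x\<close> modulo \<open>k\<close>, with
    \<open>k - 1\<close> standing for -1.\<close>
  define r where "r = (a + (k - 1) * (m * x)) mod k"
  have k: "0 < k" using a by simp
  have r: "r < k" using k by (simp add: r_def)
  have "(m * x + r) mod k = (m * x + (a + (k - 1) * (m * x))) mod k"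
    by (simp add: r_def mod_add_right_eq)
  also have "m * x + (a + (k - 1) * (m * x)) = a + k * (m * x)"
    using k by (cases k) auto
  finally have ra: "(m * x + r) mod k = a" using a by simp
  \<comment> \<open>Unroll the cycle from \<open>m * x\<close>: \<open>a\<close> recurs at the
    offsets \<open>r + t * k\<close>, and dividing by \<open>m\<close> finds the interval
    hit.\<close>
  have "(\<lambda>t. (r + t * k) div m) ` {..<i} \<subseteq> J"
  proof (intro image_subsetI)
    fix t assume "t \<in> {..<i}"
    then have "Suc t * k \<le> i * k" by (intro mult_right_mono) auto
    then have p: "r + t * k < m * M" using r wind by simp
    then have m0: "0 < m" by (cases m) auto
    let ?j = "(r + t * k) div m" and ?l = "(r + t * k) mod m"
    have "?j < M" using p by (simp add: less_mult_imp_div_less mult.commute)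
    moreover have "(m * b ?j + ?l) mod k = (m * (x + ?j) + ?l) mod k"
      unfolding b_def by (metis mod_add_left_eq mod_mult_right_eq)
    moreover have "m * (x + ?j) + ?l = m * x + r + t * k"
      by (simp add: distrib_left)
    ultimately show "?j \<in> J"
      using ra m0 by (auto simp: J_def cyclic_interval_def intro!: image_eqI[of _ _ ?l])
  qed
  \<comment> \<open>Recurrences are \<open>k > m\<close> apart, so no interval is hit twice.\<close>
  moreover have "inj_on (\<lambda>t. (r + t * k) div m) {..<i}"
  proof -
    have "(r + t * k) div m < (r + u * k) div m" if "t < u" "u < i" for t u
    proof -
      have "Suc t * k \<le> u * k" using that(1) by (intro mult_right_mono) auto
      then have le: "(r + t * k) + m \<le> r + u * k" using m by simp
      have "0 < i * k" using that k by simp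
      then have m0: "0 < m" using wind by (cases m) auto
      then have "Suc ((r + t * k) div m) = ((r + t * k) + m) div m" by simp
      also have "\<dots> \<le> (r + u * k) div m" using le by (rule div_le_mono)
      finally show ?thesis by simp
    qed
    then show ?thesis
      by (metis (mono_tags, lifting) inj_onI lessThan_iff less_irrefl_nat linorder_neqE_nat)
  qed
  moreover have finJ: "finite J" by (simp add: J_def)
  ultimately have "i \<le> card J" using card_inj_on_le[of _ "{..<i}" J] by simp
  have "{b \<in> cyclic_interval k x M. a \<notin> cyclic_interval k (m * b) m} \<subseteq> b ` ({..<M} - J)"
    by (auto simp: cyclic_interval_def[of k x M] J_def b_def)
  then have "card {b \<in> cyclic_interval k x M. a \<notin> cyclic_interval k (m * b) m} \<le> card ({..<M} - J)"
    by (meson card_image_le card_mono finite_Diff finite_imageI finite_lessThan le_trans)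
  also have "\<dots> = M - card J" by (subst card_Diff_subset) (auto simp: J_def)
  finally show ?thesis using \<open>i \<le> card J\<close> by simp
qed

text \<open>If \<open>b\<close> lies \<open>d\<close> steps after \<open>c\<close>, then
  \<open>c\<close> lies \<open>2 * m - 1 - d\<close> steps after \<open>b + 1\<close>; one of these
  distances is below \<open>m\<close>.\<close>

lemma complementary_cyclic_intervals:
  assumes "b < 2 * m" "c < 2 * m"
  shows "b \<in> cyclic_interval (2 * m) c m \<or> c \<in> cyclic_interval (2 * m) (b + 1) m"
proof -
  define d where "d = (if c \<le> b then b - c else b + 2 * m - c)"
  have d: "d < 2 * m" using assms by (auto simp: d_def)
  show ?thesis
  proof (cases "d < m")
    case True
    have "(c + d) mod (2 * m) = b" using assms by (auto simp: d_def)
    then show ?thesis using True by (auto simp: cyclic_interval_def)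
  next
    case False
    have "b + 1 + (2 * m - 1 - d) = (if c \<le> b then c + 2 * m else c)"
      using assms by (auto simp: d_def)
    then have "(b + 1 + (2 * m - 1 - d)) mod (2 * m) = c"
      using assms by auto
    moreover have "2 * m - 1 - d < m" using False d by linarith
    ultimately show ?thesis unfolding cyclic_interval_def by force
  qed
qed

text \<open>
  The colours excluded for the sage at distance \<open>i\<close> from an end, given the colour \<open>c\<close> of the next
  sage inwards; the last offset \<open>e\<close> makes the two middle sages complement each other.
\<close>

definition excluded :: "nat \<Rightarrow> nat \<Rightarrow> nat \<Rightarrow> nat \<Rightarrow> nat set" where
  "excluded s e i c = cyclic_interval (4 * s - 2) (if Suc i = s then c + e else (s + i) * c) (s + i)"

text \<open>Here \<open>a\<close> is the colour of the outer neighbour. A \<open>b\<close> whose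
  interval contains \<open>a\<close> is skipped: some sage further out has then guessed
  right.\<close>

definition guess :: "nat \<Rightarrow> nat \<Rightarrow> nat \<Rightarrow> nat \<Rightarrow> nat \<Rightarrow> nat set" where
  "guess s e i a c = {b \<in> excluded s e i c. i = 0 \<or> a \<notin> excluded s e (i - 1) b}"

lemma guess_subset: "s \<ge> 1 \<Longrightarrow> guess s e i a c \<subseteq> {..<4 * s - 2}"
  using cyclic_interval_subset[of "4 * s - 2"] by (auto simp: guess_def excluded_def)

lemma card_guess_le:
  assumes "i < s" and "i \<noteq> 0 \<Longrightarrow> a < 4 * s - 2"
  shows "card (guess s e i a c) \<le> s"
proof (cases i)
  case 0
  then have "card (guess s e i a c) = card (excluded s e 0 c)" by (simp add: guess_def)
  also have "\<dots> \<le> s" unfolding excluded_def cyclic_interval_def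
    by (rule card_image_le[THEN order_trans]) auto
  finally show ?thesis .
next
  case (Suc l)
  obtain d where d: "s = Suc i + d" using \<open>i < s\<close> less_iff_Suc_add by auto
  have "4 * s - 2 = 2 * i + 2 * i + 4 * d + 2" using d by simp
  \<comment> \<open>The right side exceeds the left by \<open>d * (d + 1)\<close>.\<close>
  then have "i * (4 * s - 2) \<le> (s + l) * (s + i)"
    by (simp add: d Suc algebra_simps)
  then have "card {b \<in> cyclic_interval (4 * s - 2) x (s + i).
      a \<notin> cyclic_interval (4 * s - 2) ((s + l) * b) (s + l)} \<le> s + i - i" for x
    using assms Suc by (intro card_uncovered_le) auto
  then show ?thesis using assms Suc by (simp add: guess_def excluded_def)
qed

lemma not_excludedI:
  assumes "\<And>i. i < s \<Longrightarrow> c i \<notin> guess s e i (c (i - 1)) (c (Suc i))" and "i < s"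
  shows "c i \<notin> excluded s e i (c (Suc i))"
  using \<open>i < s\<close>
proof (induction i)
  case 0
  then show ?case using assms(1)[of 0] by (simp add: guess_def)
next
  case (Suc i)
  then show ?case using assms(1)[of "Suc i"] by (simp add: guess_def)
qed

lemma winning_path_graph:
  assumes s: "s \<ge> 1" and n: "n \<ge> 2 * s"
  shows "winning_game (path_graph n) (\<lambda>_. 4 * s - 2) (\<lambda>_. s)"
proof (rule winning_gameI)
  let ?k = "4 * s - 2" and ?N = "neighbours (path_graph n)"
  \<comment> \<open>The second block mirrors the first, with \<open>Suc v\<close> as outer
    neighbour; sages from \<open>2 * s\<close> on guess nothing.\<close>
  let ?F = "\<lambda>v c. if v < s then guess s 0 v (c (v - 1)) (c (Suc v))
    else if v < 2 * s then guess s 1 (2 * s - 1 - v) (c (Suc v)) (c (v - 1)) else {}"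
  show "?F v c \<subseteq> {..<?k}" for v c
    using guess_subset[OF s] by auto
  show "0 < ?k" using s by simp
  show "card (?F v c) \<le> s" if v: "v \<in> pverts (path_graph n)"
    and c: "c \<in> hat_colourings (\<lambda>_. ?k) (?N v)" for v c
  proof -
    have nb: "c u < ?k" if "u \<in> ?N v" for u
      using c that by (auto simp: hat_colourings_def)
    consider "v < s" | "s \<le> v" "v < 2 * s" | "2 * s \<le> v" by linarith
    then show ?thesis
    proof cases
      case 1
      then have "c (v - 1) < ?k" if "v \<noteq> 0"
        using that v by (intro nb) (auto simp: neighbours_path_graph)
      then show ?thesis using 1 card_guess_le by simp
    next
      case 2
      then have "c (Suc v) < ?k" if "2 * s - 1 - v \<noteq> 0"
        using that n by (intro nb) (auto simp: neighbours_path_graph)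
      moreover have "2 * s - 1 - v < s" using 2 by linarith
      ultimately show ?thesis using 2 card_guess_le by simp
    qed simp
  qed
  show "\<exists>v\<in>pverts (path_graph n). c v \<in> ?F v (restrict c (?N v))"
    if c: "c \<in> hat_colourings (\<lambda>_. ?k) (pverts (path_graph n))" for c
  proof (rule ccontr)
    assume "\<not> ?thesis"
    then have lose: "c v \<notin> ?F v (restrict c (?N v))" if "v < n" for v using that by auto
    have left: "c i \<notin> guess s 0 i (c (i - 1)) (c (Suc i))" if "i < s" for i
      using lose[of i] that n by (cases i) (auto simp: neighbours_path_graph guess_def)
    define c' where "c' i = c (2 * s - 1 - i)" for i
    have right: "c' i \<notin> guess s 1 i (c' (i - 1)) (c' (Suc i))" if i: "i < s" for i
    proof -
      define v where "v = 2 * s - 1 - i"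
      have v: "s \<le> v" "v < 2 * s" "2 * s - 1 - v = i" "v - 1 = 2 * s - 1 - Suc i"
        using i by (auto simp: v_def)
      have "restrict c (?N v) (v - 1) = c' (Suc i)"
        using v s n by (auto simp: neighbours_path_graph c'_def)
      moreover have "restrict c (?N v) (Suc v) = c' (i - 1)" if "i \<noteq> 0"
      proof -
        have "Suc v = 2 * s - 1 - (i - 1)" "Suc v < n" using i that n by (auto simp: v_def)
        then show ?thesis by (simp add: neighbours_path_graph c'_def)
      qed
      moreover have "c v = c' i" by (simp add: c'_def v_def)
      moreover have "c v \<notin> guess s 1 i (restrict c (?N v) (Suc v)) (restrict c (?N v) (v - 1))"
        using lose[of v] v(1-3) n by (simp del: restrict_apply)
      ultimately show ?thesis by (cases "i = 0") (simp_all add: guess_def)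
    qed
    \<comment> \<open>The offsets 0 and 1 yield the two complementary intervals, with
      \<open>m = 2 * s - 1\<close>.\<close>
    have "c (s - 1) \<notin> excluded s 0 (s - 1) (c s)"
      using not_excludedI[of s c 0 "s - 1"] left s by simp
    moreover have "c s \<notin> excluded s 1 (s - 1) (c (s - 1))"
    proof -
      have "c' (s - 1) = c s" "c' s = c (s - 1)"
        using s by (auto simp: c'_def intro: arg_cong[of _ _ c])
      then show ?thesis using not_excludedI[of s c' 1 "s - 1"] right s by simp
    qed
    moreover have "c (s - 1) < ?k" "c s < ?k"
      using c s n by (auto simp: hat_colourings_def PiE_iff)
    moreover have "?k = 2 * (2 * s - 1)" "s + (s - 1) = 2 * s - 1" using s by simp_all
    ultimately show False
      using complementary_cyclic_intervals[of "c (s - 1)" "2 * s - 1" "c s"] s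
      by (simp add: excluded_def)
  qed
qed

theorem theorem3p4:
  fixes s :: nat
  assumes "s \<ge> 1"
  shows "HG_class s paths = enat (4 * s - 2)
    \<and> (\<forall>n. HG s (path_graph n) < enat (4 * s - 1))
    \<and> (\<forall>n\<ge>2 * s. HG s (path_graph n) = enat (4 * s - 2))"
proof -
  have le: "HG s (path_graph n) \<le> enat (4 * s - 2)" for n
    unfolding HG_def using winning_path_graph_less[OF assms] by (intro SUP_least) fastforce
  have "enat (4 * s - 2) \<le> HG s (path_graph n)" if "n \<ge> 2 * s" for n
    unfolding HG_def using winning_path_graph[OF assms that] by (intro SUP_upper) simp
  then have eq: "HG s (path_graph n) = enat (4 * s - 2)" if "n \<ge> 2 * s" for n
    using le that by (simp add: antisym)
  have "HG_class s paths \<le> enat (4 * s - 2)"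
    unfolding HG_class_def paths_def using le by (auto intro: SUP_least)
  moreover have "enat (4 * s - 2) \<le> HG_class s paths"
    unfolding HG_class_def using eq[of "2 * s"] assms
    by (intro SUP_upper2[of "path_graph (2 * s)"]) (auto simp: paths_def)
  moreover have "HG s (path_graph n) < enat (4 * s - 1)" for n
    using le by (rule order.strict_trans1) (use assms in simp)
  ultimately show ?thesis using eq by (simp add: antisym)
qed

end
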